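(* Let $(X,\|\cdot\|)$ be a real Banach space with $\dim X>1$, let $\tau_{\|\cdot\|}$ be its norm topology, and let $\rho$ be the projective equivalence relation on $X\setminus\{0\}$. Let $\mathcal{F}=S_{X^*}$ be the set of all norm-one continuous linear functionals on $X$. Then there exists a $\rho$-admissible subset $\mathcal{A}_X$ of $X$ such that $\mathcal{P}_B=\mathcal{P}_{(\tau_{\|\cdot\|},\mathcal{F},\mathcal{A}_X)}$; in other words, Birkhoff-James orthogonality is equivalent to $\perp_{(\tau_{\|\cdot\|},\mathcal{F},\mathcal{A}_X)}$.
   Context: Projective relation: for $u,v\in X\setminus\{0\}$, $u\,\rho\,v$ iff $u=tv$ for some non-zero $t\in\mathbb{R}$. A subset $\mathcal{A}_X\subset X$ is $\rho$-admissible if it consists of exactly one element from each equivalence class of $\rho$. For non-zero $x\in X$, $a_x$ denotes the unique element of $\mathcal{A}_X$ equivalent to $x$. Orthogonality: let $\tau$ be a topology on $X$, $\mathcal{F}$ a family of continuous functions $(X,\tau)\to\mathbb{R}$ (with $\mathbb{R}$ carrying the usual topology), and $\mathcal{A}_X$ a $\rho$-admissible set. For $u,v\in\mathcal{A}_X$, $u\perp_{(\tau,\mathcal{F},\mathcal{A}_X)}v$ means that there is $f\in\mathcal{F}$ with (i) $f(u)=\sup_{z\in\mathcal{A}_X}|f(z)|$ and (ii) $f(\lambda v)=0$ for all $\lambda\in\mathbb{R}$. For non-zero $x,y\in X$, $x\perp_{(\tau,\mathcal{F},\mathcal{A}_X)}y$ means $a_x\perp_{(\tau,\mathcal{F},\mathcal{A}_X)}a_y$.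 If $x=0$ or $y=0$, then $x\perp_{(\tau,\mathcal{F},\mathcal{A}_X)}y$ holds by definition. Put $\mathcal{P}_{(\tau,\mathcal{F},\mathcal{A}_X)}=\{(x,y)\in X\times X: x\perp_{(\tau,\mathcal{F},\mathcal{A}_X)}y\}$. Birkhoff-James orthogonality in $(X,\|\cdot\|)$: $x\perp_B y$ iff $\|x\|\le\|x+\lambda y\|$ for all $\lambda\in\mathbb{R}$; $\mathcal{P}_B=\{(x,y)\in X\times X: x\perp_B y\}$. *)

theory Defs
  imports "HOL-Analysis.Analysis"
begin

text \<open>The library's \<open>dim\<close> is natural-number valued and equals 0 on infinite-dimensional spaces,
  so \<open>dim X > 1\<close> is stated through the cardinality of a Hamel basis.\<close>

definition dim_gt_one :: "'a::real_vector itself \<Rightarrow> bool" where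
  "dim_gt_one _ \<longleftrightarrow>
     (\<exists>B::'a set. independent B \<and> span B = UNIV \<and> (infinite B \<or> card B > 1))"

definition proj_rel :: "('a::real_vector \<times> 'a) set" where
  "proj_rel = {(u, v). u \<noteq> 0 \<and> v \<noteq> 0 \<and> (\<exists>t::real. t \<noteq> 0 \<and> u = t *\<^sub>R v)}"

definition rho_admissible :: "'a::real_vector set \<Rightarrow> bool" where
  "rho_admissible A \<longleftrightarrow>
     A \<subseteq> UNIV - {0} \<and> (\<forall>C \<in> (UNIV - {0}) // proj_rel. \<exists>!a. a \<in> A \<and> a \<in> C)"

definition proj_rep :: "'a::real_vector set \<Rightarrow> 'a \<Rightarrow> 'a" where
  "proj_rep A x = (THE a. a \<in> A \<and> (a, x) \<in> proj_rel)"

definition orth_data :: "'a::real_vector topology \<Rightarrow> ('a \<Rightarrow> real) set \<Rightarrow> 'a set \<Rightarrow> bool" where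
  "orth_data \<tau> F A \<longleftrightarrow>
     topspace \<tau> = UNIV \<and> (\<forall>f\<in>F. continuous_map \<tau> euclideanreal f) \<and> rho_admissible A"

text \<open>In the next three definitions \<open>\<tau>\<close> is only part of the notation: it constrains \<open>F\<close>
  through \<open>orth_data\<close>. The supremum is taken in the extended reals, so that
  condition (i) fails when \<open>f\<close> is unbounded on \<open>A\<close>.\<close>

definition orth_rep ::
    "'a::real_vector topology \<Rightarrow> ('a \<Rightarrow> real) set \<Rightarrow> 'a set \<Rightarrow> 'a \<Rightarrow> 'a \<Rightarrow> bool" where
  "orth_rep \<tau> F A u v \<longleftrightarrow>
     (\<exists>f\<in>F. ereal (f u) = (SUP z\<in>A. ereal \<bar>f z\<bar>) \<and> (\<forall>c::real. f (c *\<^sub>R v) = 0))"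

definition orth ::
    "'a::real_vector topology \<Rightarrow> ('a \<Rightarrow> real) set \<Rightarrow> 'a set \<Rightarrow> 'a \<Rightarrow> 'a \<Rightarrow> bool" where
  "orth \<tau> F A x y \<longleftrightarrow>
     x = 0 \<or> y = 0 \<or> orth_rep \<tau> F A (proj_rep A x) (proj_rep A y)"

definition orth_pairs ::
    "'a::real_vector topology \<Rightarrow> ('a \<Rightarrow> real) set \<Rightarrow> 'a set \<Rightarrow> ('a \<times> 'a) set" where
  "orth_pairs \<tau> F A = {(x, y). orth \<tau> F A x y}"

definition birkhoff_orth :: "'a::real_normed_vector \<Rightarrow> 'a \<Rightarrow> bool" where
  "birkhoff_orth x y \<longleftrightarrow> (\<forall>c::real. norm x \<le> norm (x + c *\<^sub>R y))"

definition birkhoff_pairs :: "('a::real_normed_vector \<times> 'a) set" where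
  "birkhoff_pairs = {(x, y). birkhoff_orth x y}"

definition dual_sphere :: "('a::real_normed_vector \<Rightarrow> real) set" where
  "dual_sphere = blinfun_apply ` {\<phi> :: 'a \<Rightarrow>\<^sub>L real. norm \<phi> = 1}"

end

theory Submission
  imports Defs
begin

text \<open>Take \<open>A\<close> to consist of one unit vector from each line through the origin. A norm-one functional
  \<open>f\<close> then has supremum 1 on \<open>A\<close>, so \<open>f u = Sup \<bar>f\<bar>\<close> says that \<open>f\<close> supports the unit ball at \<open>u\<close>, and
  the claim becomes James's criterion: \<open>u\<close> is Birkhoff-James orthogonal to \<open>v\<close> iff some support
  functional at \<open>u\<close> vanishes at \<open>v\<close>. The existence of the functional is a Hahn-Banach argument,
  carried out here through the fact that a minimal sublinear functional is linear.\<close>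

section \<open>Sublinear functionals\<close>

definition sublinear :: "('a::real_vector \<Rightarrow> real) \<Rightarrow> bool" where
  "sublinear q \<longleftrightarrow>
     (\<forall>x y. q (x + y) \<le> q x + q y) \<and> (\<forall>t x. 0 \<le> t \<longrightarrow> q (t *\<^sub>R x) = t * q x)"

lemma sublinear_add: "sublinear q \<Longrightarrow> q (x + y) \<le> q x + q y"
  and sublinear_scaleR: "sublinear q \<Longrightarrow> 0 \<le> t \<Longrightarrow> q (t *\<^sub>R x) = t * q x"
  by (auto simp: sublinear_def)

text \<open>Applying \<open>le\<close> with \<open>inverse t\<close> to \<open>t *\<^sub>R x\<close>
  gives the reverse inequality, so homogeneity needs only one direction. This suits functionals
  defined as infima.\<close>

lemma sublinearI:
  assumes add: "\<And>x y. q (x + y) \<le> q x + q y"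
    and zero: "q 0 = 0"
    and le: "\<And>t x. 0 < t \<Longrightarrow> q (t *\<^sub>R x) \<le> t * q x"
  shows "sublinear q"
proof -
  have "q (t *\<^sub>R x) = t * q x" if "0 \<le> t" for t x
  proof (cases "t = 0")
    case False
    then have "0 < t"
      using that by simp
    moreover have "q x \<le> inverse t * q (t *\<^sub>R x)"
      using le[of "inverse t" "t *\<^sub>R x"] \<open>0 < t\<close> by simp
    ultimately have "t * q x \<le> q (t *\<^sub>R x)"
      by (simp add: field_simps)
    then show ?thesis
      using le[OF \<open>0 < t\<close>, of x] by simp
  qed (simp add: zero)
  then show ?thesis
    using add by (auto simp: sublinear_def)
qed

lemma sublinear_zero: "sublinear q \<Longrightarrow> q 0 = 0"
  using sublinear_scaleR[of q 0 0] by simp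

lemma sublinear_diff_le: "sublinear q \<Longrightarrow> q x - q (- y) \<le> q (x + y)"
  using sublinear_add[of q "x + y" "- y"] by simp

lemma sublinear_ge_neg: "sublinear q \<Longrightarrow> - q (- x) \<le> q x"
  using sublinear_diff_le[of q 0 x] by (simp add: sublinear_zero)

lemma sublinear_norm: "sublinear norm"
  by (simp add: sublinear_def norm_triangle_ineq)

text \<open>Subadditivity gives the converse of \<open>odd\<close>, so \<open>q\<close> is odd. Then
  the lower estimate \<open>q x - q (- y)\<close> for \<open>q (x + y)\<close> coincides with the
  upper one.\<close>

lemma sublinear_odd_imp_linear:
  assumes q: "sublinear q" and odd: "\<And>x. q (- x) \<le> - q x"
  shows "linear q"
proof -
  have neg: "q (- x) = - q x" for x
    using odd[of x] sublinear_ge_neg[OF q, of x] by simp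
  show ?thesis
  proof (rule linearI)
    show "q (x + y) = q x + q y" for x y
      using sublinear_add[OF q, of x y] sublinear_diff_le[OF q, of x y] by (simp add: neg)
    show "q (r *\<^sub>R x) = r *\<^sub>R q x" for r x
    proof (cases "0 \<le> r")
      case False
      then show ?thesis
        using sublinear_scaleR[OF q, of "- r" x] neg[of "r *\<^sub>R x"] by simp
    qed (simp add: sublinear_scaleR[OF q])
  qed
qed

text \<open>A pair \<open>(k, a)\<close> of the cone encodes the constraint \<open>a \<le> f k\<close> on a linear functional \<open>f\<close> below
  \<open>q\<close>; the new functional is the largest sublinear one below \<open>q\<close> that forces these constraints.\<close>

lemma sublinear_below_with_constraints:
  fixes q :: "'a::real_vector \<Rightarrow> real" and C :: "('a \<times> real) set"
  assumes q: "sublinear q" and C: "convex_cone C"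
    and dom: "\<And>k a. (k, a) \<in> C \<Longrightarrow> a \<le> q k"
  obtains p where "sublinear p" "\<And>x. p x \<le> q x" "\<And>k a. (k, a) \<in> C \<Longrightarrow> p (- k) \<le> - a"
proof
  \<comment> \<open>If \<open>f\<close> is linear, \<open>f \<le> q\<close> and
    \<open>a \<le> f k\<close>, then \<open>f x = f (x + k) - f k \<le> q (x + k) - a\<close>. Hence
    the infimum of these bounds over \<open>(k, a)\<close> in \<open>C\<close> is the natural
    candidate.\<close>
  define g where "g x z = q (x + fst z) - snd z" for x and z :: "'a \<times> real"
  define p where "p x = (INF z\<in>C. g x z)" for x
  have C0: "(0, 0) \<in> C"
    using C by (metis convex_cone_contains_0 zero_prod_def)
  \<comment> \<open>Compatibility of the constraints with \<open>q\<close> enters here: it keeps the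
    infimum finite.\<close>
  have lower: "- q (- x) \<le> g x z" if "z \<in> C" for x z
    using sublinear_diff_le[OF q, of "fst z" x] dom[of "fst z" "snd z"] that
    by (simp add: g_def add.commute)
  have bdd: "bdd_below (g x ` C)" for x
    by (rule bdd_belowI2[OF lower])
  have p_le: "p x \<le> g x z" if "z \<in> C" for x z
    unfolding p_def using that by (rule cINF_lower[OF bdd])
  have p_ge: "m \<le> p x" if "\<And>z. z \<in> C \<Longrightarrow> m \<le> g x z" for m x
    unfolding p_def using C0 that by (intro cINF_greatest) auto
  show p_le_q: "p x \<le> q x" for x
    using p_le[OF C0, of x] by (simp add: g_def)
  show "p (- k) \<le> - a" if "(k, a) \<in> C" for k a
    using p_le[OF that, of "- k"] by (simp add: g_def sublinear_zero[OF q])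
  show "sublinear p"
  proof (rule sublinearI)
    fix x y
    \<comment> \<open>As \<open>C\<close> is closed under addition, \<open>z\<close> and
      \<open>w\<close> can vary independently, and the two infima are then taken one after the
      other.\<close>
    have *: "p (x + y) \<le> g x z + g y w" if "z \<in> C" "w \<in> C" for z w
    proof -
      have "z + w \<in> C"
        using C that by (simp add: convex_cone_add)
      then have "p (x + y) \<le> g (x + y) (z + w)"
        by (rule p_le)
      also have "\<dots> \<le> g x z + g y w"
        using sublinear_add[OF q, of "x + fst z" "y + fst w"]
        by (simp add: g_def algebra_simps)
      finally show ?thesis .
    qed
    have "p (x + y) - g x z \<le> p y" if "z \<in> C" for z
      using *[OF that] by (intro p_ge) (simp add: algebra_simps)
    then have "p (x + y) - p y \<le> p x"
      by (intro p_ge) (simp add: algebra_simps)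
    then show "p (x + y) \<le> p x + p y"
      by simp
  next
    show "p 0 = 0"
    proof (rule antisym)
      show "p 0 \<le> 0"
        using p_le_q[of 0] by (simp add: sublinear_zero[OF q])
      show "0 \<le> p 0"
        using lower[of _ 0] by (intro p_ge) (simp add: sublinear_zero[OF q])
    qed
  next
    fix t :: real and x assume t: "0 < t"
    have "p (t *\<^sub>R x) / t \<le> p x"
    proof (rule p_ge)
      fix z assume "z \<in> C"
      then have "p (t *\<^sub>R x) \<le> g (t *\<^sub>R x) (t *\<^sub>R z)"
        using C t by (intro p_le) (simp add: convex_cone_scaleR)
      also have "\<dots> = t * g x z"
        using sublinear_scaleR[OF q, of t "x + fst z"] t by (simp add: g_def algebra_simps)
      finally show "p (t *\<^sub>R x) / t \<le> g x z"
        using t by (simp add: field_simps)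
    qed
    then show "p (t *\<^sub>R x) \<le> t * p x"
      using t by (simp add: field_simps)
  qed
qed

section \<open>Minimal sublinear functionals and the Hahn-Banach argument\<close>

lemma sublinear_chain_Inf:
  fixes C :: "('a::real_vector \<Rightarrow> real) set"
  assumes ne: "C \<noteq> {}" and sub: "\<And>q. q \<in> C \<Longrightarrow> sublinear q" and below: "\<And>q. q \<in> C \<Longrightarrow> q \<le> p"
    and chain: "\<And>q r. q \<in> C \<Longrightarrow> r \<in> C \<Longrightarrow> q \<le> r \<or> r \<le> q"
  shows "sublinear (\<lambda>x. INF q\<in>C. q x)" "\<And>q x. q \<in> C \<Longrightarrow> (INF q\<in>C. q x) \<le> q x"
proof -
  define m where "m x = (INF q\<in>C. q x)" for x
  have lower: "- p (- x) \<le> q x" if "q \<in> C" for q x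
    using sublinear_ge_neg[OF sub[OF that], of x] le_funD[OF below[OF that], of "- x"] by simp
  have bdd: "bdd_below ((\<lambda>q. q x) ` C)" for x
    by (rule bdd_belowI2[OF lower])
  have m_le: "m x \<le> q x" if "q \<in> C" for q x
    unfolding m_def using that by (intro cINF_lower[OF bdd])
  have m_ge: "c \<le> m x" if "\<And>q. q \<in> C \<Longrightarrow> c \<le> q x" for c x
    unfolding m_def using ne that by (intro cINF_greatest) auto
  have "sublinear m"
  proof (rule sublinearI)
    fix x y
    have *: "m (x + y) \<le> q x + r y" if qr: "q \<in> C" "r \<in> C" for q r
    proof -
      \<comment> \<open>The smaller of \<open>q\<close> and \<open>r\<close> serves as
        \<open>s\<close>, so that subadditivity is used for a single functional.\<close>
      from chain[OF qr] obtain s where "s \<in> C" "s \<le> q" "s \<le> r"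
        using qr by (metis order_refl)
      then show ?thesis
        using m_le[of s "x + y"] sublinear_add[OF sub, of s x y] le_funD[of s q x] le_funD[of s r y]
        by linarith
    qed
    have "m (x + y) - q x \<le> m y" if "q \<in> C" for q
      using *[OF that] by (intro m_ge) (simp add: algebra_simps)
    then have "m (x + y) - m y \<le> m x"
      by (intro m_ge) (simp add: algebra_simps)
    then show "m (x + y) \<le> m x + m y"
      by simp
  next
    have "m 0 = (INF q\<in>C. 0)"
      using sublinear_zero[OF sub] unfolding m_def by (intro arg_cong[of _ _ Inf] image_cong) simp_all
    then show "m 0 = 0"
      using ne by simp
  next
    fix t :: real and x assume t: "0 < t"
    have "m (t *\<^sub>R x) / t \<le> m x"
      using m_le[of _ "t *\<^sub>R x"] sublinear_scaleR[OF sub, of _ t x] t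
      by (intro m_ge) (fastforce simp: field_simps)
    then show "m (t *\<^sub>R x) \<le> t * m x"
      using t by (simp add: field_simps)
  qed
  then show "sublinear (\<lambda>x. INF q\<in>C. q x)"
    unfolding m_def .
  show "(INF q\<in>C. q x) \<le> q x" if "q \<in> C" for q x
    using m_le[OF that] unfolding m_def .
qed

text \<open>Zorn's lemma for the reversed pointwise order yields a minimal sublinear functional
  below \<open>p\<close>; minimality forces it to be odd, hence linear.\<close>

lemma exists_linear_le_sublinear:
  fixes p :: "'a::real_vector \<Rightarrow> real"
  assumes p: "sublinear p"
  obtains f where "linear f" "\<And>x. f x \<le> p x"
proof -
  define S where "S = {q. sublinear q \<and> q \<le> p}"
  have "\<exists>m\<in>S. \<forall>q\<in>S. m \<ge> q \<longrightarrow> q = m"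
  proof (rule predicate_Zorn)
    show "partial_order_on S (relation_of (\<ge>) S)"
      by (auto intro!: partial_order_on_relation_ofI)
  next
    fix C assume C: "C \<in> Chains (relation_of (\<ge>) S)"
    show "\<exists>u\<in>S. \<forall>q\<in>C. q \<ge> u"
    proof (cases "C = {}")
      case True
      then show ?thesis
        using p by (auto simp: S_def)
    next
      case False
      have CS: "C \<subseteq> S"
        using C by (auto simp: Chains_def relation_of_def)
      have *: "sublinear q" "q \<le> p" if "q \<in> C" for q
        using CS that by (auto simp: S_def)
      have "q \<le> r \<or> r \<le> q" if "q \<in> C" "r \<in> C" for q r
        using C that by (auto simp: Chains_def relation_of_def)
      note inf = sublinear_chain_Inf[OF False * this]
      have "(\<lambda>x. INF q\<in>C. q x) \<le> p"
      proof (rule le_funI)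
        fix x
        from False obtain q where "q \<in> C"
          by blast
        then show "(INF q\<in>C. q x) \<le> p x"
          using inf(2) *(2) by (meson le_funD order_trans)
      qed
      with inf show ?thesis
        by (auto simp: S_def le_fun_def intro!: bexI[of _ "\<lambda>x. INF q\<in>C. q x"])
    qed
  qed
  then obtain m where m: "sublinear m" "m \<le> p"
    and min: "\<And>q. sublinear q \<Longrightarrow> q \<le> m \<Longrightarrow> q = m"
    by (auto simp: S_def)
  have "m (- x) \<le> - m x" for x
  proof -
    \<comment> \<open>This ray encodes the constraint \<open>m x \<le> f x\<close>. The functional
      forcing it lies below \<open>m\<close>, so it equals \<open>m\<close> by minimality, and the
      bound at \<open>- x\<close> becomes oddness.\<close>
    let ?C = "(\<lambda>t. (t *\<^sub>R x, t * m x)) ` {0..}"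
    have "linear (\<lambda>t. (t *\<^sub>R x, t * m x))"
      by (rule linearI) (simp_all add: algebra_simps)
    moreover have "convex_cone {0::real..}"
      by (simp add: convex_cone_iff)
    ultimately have "convex_cone ?C"
      by (simp add: convex_cone_linear_image)
    then obtain q where q: "sublinear q" "\<And>y. q y \<le> m y" "\<And>k a. (k, a) \<in> ?C \<Longrightarrow> q (- k) \<le> - a"
      by (rule sublinear_below_with_constraints[OF m(1), of ?C])
        (auto simp: sublinear_scaleR[OF m(1)])
    have "q = m"
      using q by (intro min) (auto simp: le_fun_def)
    moreover have "(x, m x) \<in> ?C"
      by (auto intro!: image_eqI[of _ _ 1])
    ultimately show ?thesis
      using q(3) by blast
  qed
  then have "linear m"
    by (rule sublinear_odd_imp_linear[OF m(1)])
  with m(2) show thesis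
    by (auto simp: le_fun_def intro: that)
qed

section \<open>Support functionals and Birkhoff-James orthogonality\<close>

lemma birkhoff_orth_scaleR:
  assumes "s \<noteq> 0" "t \<noteq> 0" "birkhoff_orth x y"
  shows "birkhoff_orth (s *\<^sub>R x) (t *\<^sub>R y)"
  unfolding birkhoff_orth_def
proof
  fix c
  have "norm (s *\<^sub>R x) \<le> \<bar>s\<bar> * norm (x + (c * t / s) *\<^sub>R y)"
    using assms(3) by (simp add: birkhoff_orth_def mult_left_mono)
  also have "\<dots> = norm (s *\<^sub>R (x + (c * t / s) *\<^sub>R y))"
    by simp
  also have "s *\<^sub>R (x + (c * t / s) *\<^sub>R y) = s *\<^sub>R x + c *\<^sub>R t *\<^sub>R y"
    using assms(1) by (simp add: algebra_simps)
  finally show "norm (s *\<^sub>R x) \<le> norm (s *\<^sub>R x + c *\<^sub>R t *\<^sub>R y)" .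
qed

text \<open>Orthogonality says precisely that the constraints \<open>norm u \<le> f u\<close> and
  \<open>f v = 0\<close> are compatible with the norm, so a linear functional below the norm can
  satisfy them. Only \<open>norm \<phi> \<le> 1\<close> is claimed: for \<open>u = 0\<close> the
  zero functional may be the only choice.\<close>

lemma birkhoff_orth_imp_support_functional:
  fixes u v :: "'a::real_normed_vector"
  assumes uv: "birkhoff_orth u v"
  obtains \<phi> :: "'a \<Rightarrow>\<^sub>L real"
    where "norm \<phi> \<le> 1" "blinfun_apply \<phi> u = norm u" "blinfun_apply \<phi> v = 0"
proof -
  \<comment> \<open>The coefficient \<open>c\<close> takes both signs, so the cone contains
    \<open>(v, 0)\<close> and \<open>(- v, 0)\<close>, which together force
    \<open>f v = 0\<close>.\<close>
  let ?C = "(\<lambda>(t, c). (t *\<^sub>R u + c *\<^sub>R v, t * norm u)) ` ({0..} \<times> UNIV)"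
  have "linear (\<lambda>(t, c). (t *\<^sub>R u + c *\<^sub>R v, t * norm u))"
    by (rule linearI) (auto simp: algebra_simps)
  moreover have "convex_cone ({0::real..} \<times> (UNIV::real set))"
    by (auto simp: convex_cone_iff zero_prod_def)
  ultimately have "convex_cone ?C"
    by (simp add: convex_cone_linear_image)
  moreover have "a \<le> norm k" if "(k, a) \<in> ?C" for k a
  proof -
    from that obtain t c where t: "0 \<le> t" and k: "k = t *\<^sub>R u + c *\<^sub>R v" and a: "a = t * norm u"
      by auto
    show ?thesis
    proof (cases "t = 0")
      case False
      then have "birkhoff_orth (t *\<^sub>R u) v"
        using birkhoff_orth_scaleR[of t 1 u v] uv by simp
      then have "norm (t *\<^sub>R u) \<le> norm k"
        by (simp add: birkhoff_orth_def k)
      then show ?thesis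
        using t a by simp
    qed (simp add: a)
  qed
  ultimately obtain p where p: "sublinear p" "\<And>x. p x \<le> norm x"
      "\<And>k a. (k, a) \<in> ?C \<Longrightarrow> p (- k) \<le> - a"
    using sublinear_below_with_constraints[OF sublinear_norm, of ?C] by blast
  obtain f where f: "linear f" "\<And>x. f x \<le> p x"
    using exists_linear_le_sublinear[OF p(1)] by blast
  have f_ge: "a \<le> f k" if "(k, a) \<in> ?C" for k a
    using p(3)[OF that] f(2)[of "- k"] linear_neg[OF f(1), of k] by simp
  have f_le: "f x \<le> norm x" for x
    using f(2) p(2) by (rule order_trans)
  have f_abs: "\<bar>f x\<bar> \<le> norm x" for x
    using f_le[of x] f_le[of "- x"] linear_neg[OF f(1), of x] by simp
  have "bounded_linear f"
    using f(1) f_abs by (intro bounded_linear.intro) (auto simp: bounded_linear_axioms_def intro!: exI[of _ 1])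
  then have Blinfun_f: "blinfun_apply (Blinfun f) = f"
    by (rule bounded_linear_Blinfun_apply)
  show thesis
  proof (rule that[of "Blinfun f"])
    show "norm (Blinfun f) \<le> 1"
      using f_abs by (intro norm_blinfun_bound) (auto simp: Blinfun_f)
    have "(u, norm u) \<in> ?C"
      by (auto intro!: image_eqI[of _ _ "(1, 0)"])
    then show "blinfun_apply (Blinfun f) u = norm u"
      using f_ge[of u "norm u"] f_le[of u] by (simp add: Blinfun_f)
    have "(v, 0) \<in> ?C"
      by (auto intro!: image_eqI[of _ _ "(0, 1)"])
    moreover have "(- v, 0) \<in> ?C"
      by (auto intro!: image_eqI[of _ _ "(0, - 1)"])
    ultimately show "blinfun_apply (Blinfun f) v = 0"
      using f_ge[of v 0] f_ge[of "- v" 0] linear_neg[OF f(1), of v] by (simp add: Blinfun_f)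
  qed
qed

text \<open>On the line through \<open>u\<close> in direction \<open>v\<close> the functional is
  constantly \<open>norm u\<close>, and it never exceeds the norm.\<close>

lemma support_functional_imp_birkhoff_orth:
  fixes \<phi> :: "'a::real_normed_vector \<Rightarrow>\<^sub>L real"
  assumes "norm \<phi> \<le> 1" "blinfun_apply \<phi> u = norm u" "blinfun_apply \<phi> v = 0"
  shows "birkhoff_orth u v"
  unfolding birkhoff_orth_def
proof
  fix c
  have "norm u = \<phi> (u + c *\<^sub>R v)"
    using assms by (simp add: blinfun.bilinear_simps)
  also have "\<dots> \<le> norm \<phi> * norm (u + c *\<^sub>R v)"
    using norm_blinfun[of \<phi> "u + c *\<^sub>R v"] by simp
  also have "\<dots> \<le> norm (u + c *\<^sub>R v)"
    using assms(1) by (simp add: mult_left_le_one_le)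
  finally show "norm u \<le> norm (u + c *\<^sub>R v)" .
qed

section \<open>Admissible sets\<close>

lemma equiv_proj_rel: "equiv (UNIV - {0}) proj_rel"
proof (rule equivI)
  show "proj_rel \<subseteq> (UNIV - {0}) \<times> (UNIV - {0})"
    by (auto simp: proj_rel_def)
  show "refl_on (UNIV - {0}) proj_rel"
    by (auto simp: proj_rel_def refl_on_def intro: exI[of _ 1])
  show "sym proj_rel"
  proof (rule symI)
    fix u v assume "(u, v) \<in> proj_rel"
    then obtain t where "u \<noteq> 0" "v \<noteq> 0" "t \<noteq> 0" "u = t *\<^sub>R v"
      by (auto simp: proj_rel_def)
    then show "(v, u) \<in> proj_rel"
      by (auto simp: proj_rel_def intro!: exI[of _ "inverse t"])
  qed
  show "trans proj_rel"
  proof (rule transI)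
    fix u v w assume "(u, v) \<in> proj_rel" "(v, w) \<in> proj_rel"
    then obtain s t where "u \<noteq> 0" "w \<noteq> 0" "s \<noteq> 0" "t \<noteq> 0" "u = s *\<^sub>R t *\<^sub>R w"
      by (auto simp: proj_rel_def)
    then show "(u, w) \<in> proj_rel"
      by (auto simp: proj_rel_def intro!: exI[of _ "s * t"])
  qed
qed

text \<open>Each class contains the normalisation \<open>sgn x\<close> of any of its members
  \<open>x\<close>, so choice can pick a unit vector from it; disjointness of classes gives
  uniqueness.\<close>

lemma exists_rho_admissible_unit:
  obtains A :: "'a::real_normed_vector set" where "rho_admissible A" "\<And>a. a \<in> A \<Longrightarrow> norm a = 1"
proof -
  let ?Q = "(UNIV - {0::'a}) // proj_rel"
  define r where "r C = (SOME a. a \<in> C \<and> norm a = 1)" for C :: "'a set"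
  have r: "r C \<in> C \<and> norm (r C) = 1" if "C \<in> ?Q" for C
  proof -
    from that obtain x where x: "x \<noteq> 0" "C = proj_rel `` {x}"
      by (auto elim: quotientE)
    then have "sgn x \<in> C"
      by (auto simp: proj_rel_def sgn_div_norm intro!: exI[of _ "norm x"])
    with x show ?thesis
      unfolding r_def by (intro someI[of "\<lambda>a. a \<in> C \<and> norm a = 1" "sgn x"]) (simp add: norm_sgn)
  qed
  have nz: "0 \<notin> C" if "C \<in> ?Q" for C
    using that by (auto simp: quotient_def proj_rel_def)
  have "rho_admissible (r ` ?Q)"
    unfolding rho_admissible_def
  proof (intro conjI ballI)
    show "r ` ?Q \<subseteq> UNIV - {0}"
      using r nz by fastforce
    fix C assume C: "C \<in> ?Q"
    show "\<exists>!a. a \<in> r ` ?Q \<and> a \<in> C"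
    proof (rule ex1I)
      show "r C \<in> r ` ?Q \<and> r C \<in> C"
        using C r by blast
      fix a assume "a \<in> r ` ?Q \<and> a \<in> C"
      then obtain D where "D \<in> ?Q" "a = r D" "r D \<in> C"
        by blast
      then show "a = r C"
        using quotient_disj[OF equiv_proj_rel C, of D] r by blast
    qed
  qed
  then show thesis
    using r by (intro that[of "r ` ?Q"]) auto
qed

lemma proj_rep_props:
  assumes A: "rho_admissible A" and x: "x \<noteq> 0"
  shows "proj_rep A x \<in> A" "(proj_rep A x, x) \<in> proj_rel"
proof -
  have "\<forall>C \<in> (UNIV - {0}) // proj_rel. \<exists>!a. a \<in> A \<and> a \<in> C"
    using A unfolding rho_admissible_def by (rule conjunct2)
  moreover have "proj_rel `` {x} \<in> (UNIV - {0}) // proj_rel"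
    using x by (intro quotientI) simp
  ultimately have "\<exists>!a. a \<in> A \<and> a \<in> proj_rel `` {x}"
    by (rule bspec)
  moreover have "a \<in> proj_rel `` {x} \<longleftrightarrow> (a, x) \<in> proj_rel" for a
    using equiv_proj_rel by (auto simp: equiv_def dest: symD)
  ultimately have "\<exists>!a. a \<in> A \<and> (a, x) \<in> proj_rel"
    by (simp only:)
  then have "proj_rep A x \<in> A \<and> (proj_rep A x, x) \<in> proj_rel"
    unfolding proj_rep_def by (rule theI')
  then show "proj_rep A x \<in> A" "(proj_rep A x, x) \<in> proj_rel"
    by auto
qed

section \<open>Comparison of the two orthogonality relations\<close>

lemma birkhoff_orth_proj_rel:
  assumes "(u, x) \<in> proj_rel" "(v, y) \<in> proj_rel"
  shows "birkhoff_orth u v \<longleftrightarrow> birkhoff_orth x y"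
proof -
  obtain s t where "s \<noteq> 0" "t \<noteq> 0" "u = s *\<^sub>R x" "v = t *\<^sub>R y"
    using assms by (auto simp: proj_rel_def)
  then show ?thesis
    using birkhoff_orth_scaleR[of s t x y] birkhoff_orth_scaleR[of "inverse s" "inverse t" u v] by auto
qed

text \<open>Every line through the origin meets \<open>A\<close> in a unit vector, so by homogeneity
  a bound on \<open>A\<close> is a bound on the whole unit sphere.\<close>

lemma rho_admissible_norm_le:
  fixes \<phi> :: "'a::real_normed_vector \<Rightarrow>\<^sub>L real"
  assumes A: "rho_admissible A" and unit: "\<And>a. a \<in> A \<Longrightarrow> norm a = 1"
    and "0 \<le> c" and c: "\<And>a. a \<in> A \<Longrightarrow> \<bar>\<phi> a\<bar> \<le> c"
  shows "norm \<phi> \<le> c"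
proof (rule norm_blinfun_bound[OF \<open>0 \<le> c\<close>])
  fix x
  show "norm (\<phi> x) \<le> c * norm x"
  proof (cases "x = 0")
    case False
    let ?a = "proj_rep A x"
    have "?a \<in> A" "(x, ?a) \<in> proj_rel"
      using proj_rep_props[OF A False] equiv_proj_rel by (auto simp: equiv_def dest: symD)
    then obtain t where "x = t *\<^sub>R ?a"
      by (auto simp: proj_rel_def)
    then have "norm (\<phi> x) = \<bar>t\<bar> * \<bar>\<phi> ?a\<bar>" "norm x = \<bar>t\<bar>"
      using unit[OF \<open>?a \<in> A\<close>]
      by (metis blinfun.scaleR_right norm_scaleR real_norm_def, metis mult.right_neutral norm_scaleR)
    then show ?thesis
      using c[OF \<open>?a \<in> A\<close>] by (simp add: mult.commute[of c] mult_left_mono)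
  qed simp
qed

lemma orth_rep_dual_sphere_iff:
  fixes A :: "'a::real_normed_vector set"
  assumes A: "rho_admissible A" and unit: "\<And>a. a \<in> A \<Longrightarrow> norm a = 1" and u: "u \<in> A"
  shows "orth_rep \<tau> dual_sphere A u v \<longleftrightarrow> birkhoff_orth u v"
proof
  assume "orth_rep \<tau> dual_sphere A u v"
  then obtain \<phi> :: "'a \<Rightarrow>\<^sub>L real" where \<phi>: "norm \<phi> = 1"
    and sup: "ereal (\<phi> u) = (SUP z\<in>A. ereal \<bar>\<phi> z\<bar>)" and v: "\<And>c. \<phi> (c *\<^sub>R v) = 0"
    unfolding orth_rep_def dual_sphere_def by blast
  have le: "\<bar>\<phi> a\<bar> \<le> \<phi> u" if "a \<in> A" for a
  proof -
    have "ereal \<bar>\<phi> a\<bar> \<le> ereal (\<phi> u)"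
      unfolding sup using that by (rule SUP_upper)
    then show ?thesis
      by simp
  qed
  \<comment> \<open>The supremum condition makes \<open>\<phi> u\<close> a bound for
    \<open>\<phi>\<close> on \<open>A\<close>; as \<open>u\<close> is a unit vector,
    \<open>\<phi>\<close> attains its norm there.\<close>
  then have "norm \<phi> \<le> \<phi> u"
    using le[OF u] by (intro rho_admissible_norm_le[OF A unit]) auto
  moreover have "\<phi> u \<le> norm \<phi> * norm u"
    using norm_blinfun[of \<phi> u] by simp
  ultimately show "birkhoff_orth u v"
    using v[of 1] unit[OF u] \<phi> by (intro support_functional_imp_birkhoff_orth[of \<phi>]) auto
next
  assume "birkhoff_orth u v"
  then obtain \<phi> :: "'a \<Rightarrow>\<^sub>L real" where \<phi>: "norm \<phi> \<le> 1" "\<phi> u = norm u" "\<phi> v = 0"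
    by (rule birkhoff_orth_imp_support_functional)
  have le: "\<bar>\<phi> a\<bar> \<le> 1" if "a \<in> A" for a
    using norm_blinfun[of \<phi> a] unit[OF that] \<phi>(1) by simp
  have "\<phi> u = 1"
    using \<phi>(2) unit[OF u] by simp
  \<comment> \<open>The value 1 at the unit vector \<open>u\<close> excludes a norm below 1, which
    places \<open>\<phi>\<close> in the dual sphere.\<close>
  moreover have "norm \<phi> = 1"
    using norm_blinfun[of \<phi> u] \<phi>(1) \<open>\<phi> u = 1\<close> unit[OF u] by simp
  moreover have "(SUP z\<in>A. ereal \<bar>\<phi> z\<bar>) = ereal (\<phi> u)"
  proof (rule SUP_eqI)
    show "ereal \<bar>\<phi> z\<bar> \<le> ereal (\<phi> u)" if "z \<in> A" for z
      using le[OF that] \<open>\<phi> u = 1\<close> by simp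
    show "ereal (\<phi> u) \<le> b" if "\<And>z. z \<in> A \<Longrightarrow> ereal \<bar>\<phi> z\<bar> \<le> b" for b
      using that[OF u] \<open>\<phi> u = 1\<close> by simp
  qed
  ultimately show "orth_rep \<tau> dual_sphere A u v"
    unfolding orth_rep_def dual_sphere_def using \<phi>(3)
    by (intro bexI[of _ "blinfun_apply \<phi>"]) (auto simp: blinfun.scaleR_right)
qed

theorem theorem2p1:
  assumes "dim_gt_one TYPE('a::banach)"
  shows "\<exists>A :: 'a set. rho_admissible A \<and>
           orth_data euclidean dual_sphere A \<and>
           birkhoff_pairs = orth_pairs euclidean dual_sphere A"
proof -
  obtain A :: "'a set" where A: "rho_admissible A" and unit: "\<And>a. a \<in> A \<Longrightarrow> norm a = 1"
    using exists_rho_admissible_unit by blast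
  have "orth_data euclidean dual_sphere A"
    using A by (auto simp: orth_data_def dual_sphere_def intro!: continuous_intros)
  moreover have "birkhoff_orth x y \<longleftrightarrow> orth euclidean dual_sphere A x y" for x y
  \<comment> \<open>With a zero vector both relations hold trivially; otherwise homogeneity of
    Birkhoff-James orthogonality allows passing to the representatives in \<open>A\<close>.\<close>
  proof (cases "x = 0 \<or> y = 0")
    case True
    then show ?thesis
      by (auto simp: orth_def birkhoff_orth_def)
  next
    case False
    then show ?thesis
      using orth_rep_dual_sphere_iff[OF A unit] proj_rep_props[OF A]
        birkhoff_orth_proj_rel[of "proj_rep A x" x "proj_rep A y" y]
      by (simp add: orth_def)
  qed
  ultimately show ?thesis
    using A by (auto simp: birkhoff_pairs_def orth_pairs_def)
qed

end
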